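(* Let $g\in\mathcal{B}$ be a non-constant function and $\gamma>0$. (i) $[V_g,A^{-\gamma}]=\{f\in H(\mathbb{D}): fg'\in A^{-(\gamma+1)}\}$. Moreover, there exists $C>0$ satisfying $$\|fg'\|_{-(\gamma+1)}\le C\|f\|_{[V_g,A^{-\gamma}]},\qquad f\in[V_g,A^{-\gamma}].$$ (ii) $[V_g,A^{-\gamma}_0]=\{f\in H(\mathbb{D}): fg'\in A^{-(\gamma+1)}_0\}$. Moreover, there exists $C>0$ satisfying $$\|fg'\|_{-(\gamma+1)}\le C\|f\|_{[V_g,A^{-\gamma}_0]},\qquad f\in[V_g,A^{-\gamma}_0].$$
   Context: $\mathbb{D}$ is the open unit disc in $\mathbb{C}$ and $H(\mathbb{D})$ is the space of analytic functions on $\mathbb{D}$. For $\gamma>0$, $A^{-\gamma}:=\{f\in H(\mathbb{D}): \|f\|_{-\gamma}:=\sup_{z\in\mathbb{D}}(1-|z|)^\gamma|f(z)|<\infty\}$ and $A^{-\gamma}_0:=\{f\in H(\mathbb{D}): \lim_{|z|\to1^-}(1-|z|)^\gamma|f(z)|=0\}$, both Banach spaces with norm $\|\cdot\|_{-\gamma}$. The Bloch space is $\mathcal{B}:=\{g\in H(\mathbb{D}): \sup_{z\in\mathbb{D}}(1-|z|)|g'(z)|<\infty\}$. The Volterra operator is $(V_gf)(z):=\int_0^zf(\xi)g'(\xi)\,d\xi$ for $f\in H(\mathbb{D})$, $z\in\mathbb{D}$. The optimal domains are $[V_g,A^{-\gamma}]:=\{f\in H(\mathbb{D}): V_gf\in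 A^{-\gamma}\}$ and $[V_g,A^{-\gamma}_0]:=\{f\in H(\mathbb{D}): V_gf\in A^{-\gamma}_0\}$, endowed with the norms $\|f\|_{[V_g,A^{-\gamma}]}:=\|V_gf\|_{-\gamma}$ and $\|f\|_{[V_g,A^{-\gamma}_0]}:=\|V_gf\|_{-\gamma}$, respectively. *)

theory Defs
  imports "HOL-Complex_Analysis.Complex_Analysis"
begin

text \<open>Functions on the unit disc are represented by total functions on the complex plane;
  their values outside the disc are irrelevant to all notions below.\<close>

abbreviation unit_disc :: "complex set" where
  "unit_disc \<equiv> ball 0 1"

definition analytic_disc :: "(complex \<Rightarrow> complex) set" where
  "analytic_disc = {f. f holomorphic_on unit_disc}"

text \<open>The norm takes values in the extended nonnegative reals, so that the supremum exists for
  every function and finiteness can serve as the membership condition.\<close>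

definition growth_norm :: "real \<Rightarrow> (complex \<Rightarrow> complex) \<Rightarrow> ennreal" where
  "growth_norm \<gamma> f = (SUP z\<in>unit_disc. ennreal ((1 - norm z) powr \<gamma> * norm (f z)))"

definition growth_space :: "real \<Rightarrow> (complex \<Rightarrow> complex) set" where
  "growth_space \<gamma> = {f \<in> analytic_disc. growth_norm \<gamma> f < \<infinity>}"

text \<open>The filter expresses that the modulus of the variable tends to 1 from the left.\<close>

definition little_growth_space :: "real \<Rightarrow> (complex \<Rightarrow> complex) set" where
  "little_growth_space \<gamma> = {f \<in> analytic_disc.
     ((\<lambda>z. (1 - norm z) powr \<gamma> * norm (f z)) \<longlongrightarrow> 0) (filtercomap norm (at_left 1))}"

definition bloch_space :: "(complex \<Rightarrow> complex) set" where
  "bloch_space = {g \<in> analytic_disc.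
     (SUP z\<in>unit_disc. ennreal ((1 - norm z) * norm (deriv g z))) < \<infinity>}"

text \<open>For analytic integrands the integral over the segment from 0 to the given point of the disc
  agrees with the integral over any other path in the disc.\<close>

definition volterra :: "(complex \<Rightarrow> complex) \<Rightarrow> (complex \<Rightarrow> complex) \<Rightarrow> complex \<Rightarrow> complex" where
  "volterra g f z = contour_integral (linepath 0 z) (\<lambda>\<xi>. f \<xi> * deriv g \<xi>)"

definition optimal_domain ::
    "(complex \<Rightarrow> complex) \<Rightarrow> (complex \<Rightarrow> complex) set \<Rightarrow> (complex \<Rightarrow> complex) set" where
  "optimal_domain g X = {f \<in> analytic_disc. volterra g f \<in> X}"

text \<open>Both optimal domains, for the growth space and for the little growth space, carry this norm.\<close>

definition optimal_domain_norm ::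
    "(complex \<Rightarrow> complex) \<Rightarrow> real \<Rightarrow> (complex \<Rightarrow> complex) \<Rightarrow> ennreal" where
  "optimal_domain_norm g \<gamma> f = growth_norm \<gamma> (volterra g f)"

end

theory Submission
  imports Defs
begin

text \<open>Put \<open>h = f g'\<close>. On the disc, \<open>F = V\<^sub>g f\<close> is the primitive of \<open>h\<close> vanishing at 0, so
  everything compares the growth of \<open>F\<close> with that of \<open>F'\<close>. Cauchy's inequality on the circle of
  radius \<open>(1 - |z|)/2\<close> about \<open>z\<close> bounds \<open>F'\<close> by \<open>F\<close>. Conversely, integrating
  \<open>|h(w)| \<le> K + M (1 - |w|) powr (- (\<gamma> + 1))\<close> along a radius gives
  \<open>|F(z)| \<le> K + (M/\<gamma>) (1 - |z|) powr (- \<gamma>)\<close>; in the little-o case \<open>M\<close> can be taken arbitrarily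
  small, at the expense of \<open>K\<close>.\<close>

section \<open>Volterra integrals as primitives on the disc\<close>

text \<open>The disc is convex, so the holomorphic integrand has a primitive \<open>G\<close> there,
  and the integral over the segment from 0 to \<open>w\<close> is \<open>G w - G 0\<close>.\<close>

lemma volterra_has_field_derivative:
  assumes "f \<in> analytic_disc" "g \<in> analytic_disc" "z \<in> unit_disc"
  shows "(volterra g f has_field_derivative f z * deriv g z) (at z)"
proof -
  have "(\<lambda>w. f w * deriv g w) holomorphic_on unit_disc"
    using assms by (auto simp: analytic_disc_def intro!: holomorphic_intros)
  then obtain G where G: "\<And>w. w \<in> unit_disc \<Longrightarrow>
      (G has_field_derivative f w * deriv g w) (at w within unit_disc)"
    using holomorphic_convex_primitive'[OF convex_ball open_ball] by blast
  have eq: "volterra g f w = G w - G 0" if "w \<in> unit_disc" for w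
  proof -
    have path: "path_image (linepath 0 w) \<subseteq> unit_disc"
      using that by (simp add: closed_segment_subset)
    have "((\<lambda>w. f w * deriv g w) has_contour_integral
        G (pathfinish (linepath 0 w)) - G (pathstart (linepath 0 w))) (linepath 0 w)"
      by (rule contour_integral_primitive[OF _ valid_path_linepath path]) (rule G)
    then show ?thesis
      by (simp add: volterra_def contour_integral_unique)
  qed
  have "((\<lambda>w. G w - G 0) has_field_derivative f z * deriv g z) (at z)"
    using G[OF assms(3)] at_within_open[OF assms(3) open_ball]
    by (auto intro!: derivative_eq_intros)
  \<comment> \<open>The two functions are known to agree only on the disc, so the derivative is
    transferred inside that open set.\<close>
  then show ?thesis
    by (rule has_field_derivative_transform_within_open[where S = unit_disc])
       (use assms eq in auto)
qed

lemma volterra_in_analytic_disc: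
  assumes "f \<in> analytic_disc" "g \<in> analytic_disc"
  shows "volterra g f \<in> analytic_disc"
  using volterra_has_field_derivative[OF assms]
  by (force simp: analytic_disc_def holomorphic_on_open)

lemma volterra_0 [simp]: "volterra g f 0 = 0"
  by (simp add: volterra_def)

section \<open>Cauchy estimates: control of the derivative by the function\<close>

text \<open>Cauchy's inequality uses \<open>F\<close> only near \<open>z\<close>, so the bound
  \<open>B\<close> is required only on a small closed disc about \<open>z\<close>. This local form
  serves both a bound on the whole disc and a smallness condition near the boundary.\<close>

lemma weighted_deriv_le:
  fixes F :: "complex \<Rightarrow> complex"
  assumes F: "F holomorphic_on unit_disc" and z: "norm z < 1" and "\<gamma> > 0"
    and B: "\<And>w. dist z w \<le> (1 - norm z) / 2 \<Longrightarrow> (1 - norm w) powr \<gamma> * norm (F w) \<le> B"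
  shows "(1 - norm z) powr (\<gamma> + 1) * norm (deriv F z) \<le> 2 powr (\<gamma> + 1) * B"
proof -
  define r where "r = (1 - norm z) / 2"
  have r: "r > 0" "1 - norm z = 2 * r" using z by (auto simp: r_def)
  \<comment> \<open>Here |w| \<le> |z| + r and 1 - |z| - r = r, so the weight at \<open>w\<close> is
    at least \<open>r powr \<gamma>\<close>.\<close>
  have near: "r \<le> 1 - norm w" if "dist z w \<le> r" for w
    using norm_triangle_ineq2[of w z] that r by (simp add: dist_norm norm_minus_commute)
  have sub: "cball z r \<subseteq> unit_disc" using near r by force
  have "norm (F w) \<le> B / r powr \<gamma>" if "norm (z - w) = r" for w
  proof -
    have "r powr \<gamma> * norm (F w) \<le> (1 - norm w) powr \<gamma> * norm (F w)"
      using near[of w] that r \<open>\<gamma> > 0\<close> by (intro mult_right_mono powr_mono2) (auto simp: dist_norm)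
    also have "\<dots> \<le> B" using B[of w] that by (simp add: dist_norm r_def)
    finally show ?thesis using r by (simp add: field_simps)
  qed
  moreover have "F holomorphic_on cball z r"
    using F sub by (rule holomorphic_on_subset)
  ultimately have "norm ((deriv ^^ 1) F z) \<le> fact 1 * (B / r powr \<gamma>) / r ^ 1"
    using r by (intro Cauchy_inequality)
       (auto intro: holomorphic_on_subset holomorphic_on_imp_continuous_on)
  then have "r powr (\<gamma> + 1) * norm (deriv F z) \<le> B"
    using r by (simp add: field_simps powr_add)
  \<comment> \<open>Since 1 - |z| = 2r, passing from \<open>r\<close> to 1 - |z| costs the factor
    \<open>2 powr (\<gamma> + 1)\<close>.\<close>
  then show ?thesis
    using r by (simp add: powr_mult mult.assoc)
qed

lemma growth_norm_le_iff:
  assumes "B \<ge> 0"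
  shows "growth_norm \<gamma> f \<le> ennreal B \<longleftrightarrow>
    (\<forall>z\<in>unit_disc. (1 - norm z) powr \<gamma> * norm (f z) \<le> B)"
  using assms by (simp add: growth_norm_def SUP_le_iff ennreal_le_iff)

lemma growth_norm_lt_top_iff:
  "growth_norm \<gamma> f < \<infinity> \<longleftrightarrow>
    (\<exists>B\<ge>0. \<forall>z\<in>unit_disc. (1 - norm z) powr \<gamma> * norm (f z) \<le> B)"
proof
  assume "growth_norm \<gamma> f < \<infinity>"
  then obtain B where "B \<ge> 0" "growth_norm \<gamma> f = ennreal B"
    by (metis ennreal_cases infinity_ennreal_def less_irrefl)
  then show "\<exists>B\<ge>0. \<forall>z\<in>unit_disc. (1 - norm z) powr \<gamma> * norm (f z) \<le> B"
    using growth_norm_le_iff[of B \<gamma> f] by auto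
next
  assume "\<exists>B\<ge>0. \<forall>z\<in>unit_disc. (1 - norm z) powr \<gamma> * norm (f z) \<le> B"
  then obtain B where "growth_norm \<gamma> f \<le> ennreal B"
    using growth_norm_le_iff by blast
  then show "growth_norm \<gamma> f < \<infinity>"
    using le_less_trans by fastforce
qed

text \<open>The weighted Cauchy estimate is uniform in \<open>z\<close>, so it passes to suprema.
  The function \<open>h\<close> has to match the derivative only on the disc, which is all that the
  norm sees.\<close>

lemma growth_norm_deriv_le:
  assumes F: "F holomorphic_on unit_disc" and "\<gamma> > 0"
    and F': "\<And>z. z \<in> unit_disc \<Longrightarrow> deriv F z = h z"
  shows "growth_norm (\<gamma> + 1) h \<le> ennreal (2 powr (\<gamma> + 1)) * growth_norm \<gamma> F"
proof (cases "growth_norm \<gamma> F")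
  case (real B)
  then have B: "(1 - norm w) powr \<gamma> * norm (F w) \<le> B" if "w \<in> unit_disc" for w
    using growth_norm_le_iff[of B \<gamma> F] that by auto
  have "(1 - norm z) powr (\<gamma> + 1) * norm (h z) \<le> 2 powr (\<gamma> + 1) * B" if "z \<in> unit_disc" for z
  proof -
    have "w \<in> unit_disc" if "dist z w \<le> (1 - norm z) / 2" for w
      using norm_triangle_ineq2[of w z] that \<open>z \<in> unit_disc\<close>
      by (simp add: dist_norm norm_minus_commute)
    then show ?thesis
      using weighted_deriv_le[OF F, of z \<gamma> B] that B \<open>\<gamma> > 0\<close> F' by simp
  qed
  then show ?thesis
    using real by (simp add: growth_norm_le_iff flip: ennreal_mult)
\<comment> \<open>If \<open>F\<close> has infinite norm, the right-hand side is infinite because its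
  constant factor is nonzero.\<close>
qed (simp add: ennreal_mult_top)

text \<open>Pulling a left neighbourhood of 1 back along \<open>norm\<close> gives an annulus \<rho>
  < |z| < 1, or the whole disc when \<rho> is negative.\<close>

lemma eventually_norm_at_left_1:
  fixes P :: "complex \<Rightarrow> bool"
  shows "eventually P (filtercomap norm (at_left 1)) \<longleftrightarrow>
    (\<exists>\<rho><1. \<forall>z. \<rho> < norm z \<longrightarrow> norm z < 1 \<longrightarrow> P z)" (is "?L \<longleftrightarrow> ?R")
proof
  assume ?L
  then show ?R
    by (auto simp: eventually_filtercomap eventually_at_left_field)
next
  assume ?R
  then obtain \<rho> where "\<rho> < 1" "\<forall>z. \<rho> < norm z \<longrightarrow> norm z < 1 \<longrightarrow> P z" by blast
  then show ?L
    unfolding eventually_filtercomap eventually_at_left_field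
    by (intro exI[of _ "\<lambda>x. \<rho> < x \<and> x < 1"]) auto
qed

lemma weighted_tendsto_0_iff:
  fixes f :: "complex \<Rightarrow> complex"
  shows "((\<lambda>z. (1 - norm z) powr \<gamma> * norm (f z)) \<longlongrightarrow> 0) (filtercomap norm (at_left 1)) \<longleftrightarrow>
    (\<forall>e>0. \<exists>\<rho><1. \<forall>z. \<rho> < norm z \<longrightarrow> norm z < 1 \<longrightarrow>
      (1 - norm z) powr \<gamma> * norm (f z) < e)"
  by (simp add: tendsto_iff eventually_norm_at_left_1 abs_mult)

lemma weighted_deriv_tendsto_0:
  fixes F :: "complex \<Rightarrow> complex"
  assumes F: "F holomorphic_on unit_disc" and "\<gamma> > 0"
    and F': "\<And>z. z \<in> unit_disc \<Longrightarrow> deriv F z = h z"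
    and lim: "((\<lambda>z. (1 - norm z) powr \<gamma> * norm (F z)) \<longlongrightarrow> 0) (filtercomap norm (at_left 1))"
  shows "((\<lambda>z. (1 - norm z) powr (\<gamma> + 1) * norm (h z)) \<longlongrightarrow> 0) (filtercomap norm (at_left 1))"
  unfolding weighted_tendsto_0_iff
proof (intro allI impI)
  fix e :: real assume "e > 0"
  \<comment> \<open>The Cauchy factor times \<open>d\<close> is e/2, which leaves room for the
    strict inequality.\<close>
  define d where "d = e / (2 * 2 powr (\<gamma> + 1))"
  have d: "d > 0" "2 powr (\<gamma> + 1) * d < e" using \<open>e > 0\<close> by (auto simp: d_def)
  obtain \<rho> where \<rho>: "\<rho> < 1"
    "\<And>w. \<rho> < norm w \<Longrightarrow> norm w < 1 \<Longrightarrow> (1 - norm w) powr \<gamma> * norm (F w) < d"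
    using lim d(1) unfolding weighted_tendsto_0_iff by blast
  show "\<exists>\<rho><1. \<forall>z. \<rho> < norm z \<longrightarrow> norm z < 1 \<longrightarrow> (1 - norm z) powr (\<gamma> + 1) * norm (h z) < e"
  \<comment> \<open>Points \<open>w\<close> of the Cauchy disc satisfy |w| \<ge> (3|z| - 1)/2, which
    exceeds \<rho> exactly when |z| > (2\<rho> + 1)/3.\<close>
  proof (intro exI[of _ "(2 * \<rho> + 1) / 3"] conjI allI impI)
    fix z :: complex assume z: "(2 * \<rho> + 1) / 3 < norm z" "norm z < 1"
    have "(1 - norm w) powr \<gamma> * norm (F w) \<le> d" if "dist z w \<le> (1 - norm z) / 2" for w
    proof -
      have "\<rho> < norm w" "norm w < 1"
        using that z norm_triangle_ineq2[of w z] norm_triangle_ineq2[of z w]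
        by (auto simp: dist_norm norm_minus_commute field_simps)
      then show ?thesis using \<rho>(2)[of w] by simp
    qed
    then have "(1 - norm z) powr (\<gamma> + 1) * norm (deriv F z) \<le> 2 powr (\<gamma> + 1) * d"
      using weighted_deriv_le[OF F z(2) \<open>\<gamma> > 0\<close>] by blast
    then show "(1 - norm z) powr (\<gamma> + 1) * norm (h z) < e"
      using d F' z by simp
  qed (use \<rho> in simp)
qed

section \<open>Integration along radii: control of the function by its derivative\<close>

lemma norm_primitive_le:
  fixes F :: "complex \<Rightarrow> complex"
  assumes F: "\<And>w. w \<in> unit_disc \<Longrightarrow> (F has_field_derivative h w) (at w)" and "F 0 = 0"
    and h: "\<And>w. w \<in> unit_disc \<Longrightarrow> norm (h w) \<le> K + M * (1 - norm w) powr (- (\<gamma> + 1))"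
    and "K \<ge> 0" "M \<ge> 0" "\<gamma> > 0" and z: "norm z < 1"
  shows "norm (F z) \<le> K + M / \<gamma> * (1 - norm z) powr (- \<gamma>)"
proof -
  \<comment> \<open>An explicit antiderivative of the bound for the speed of \<open>F\<close> along
    the radius to \<open>z\<close>; comparing increments replaces the evaluation of an
    integral.\<close>
  define \<phi> where "\<phi> t = K * norm z * t + M / \<gamma> * (1 - t * norm z) powr (- \<gamma>)" for t
  define \<phi>' where "\<phi>' t = (K + M * (1 - t * norm z) powr (- (\<gamma> + 1))) * norm z" for t
  have tz: "t * norm z < 1" if "0 \<le> t" "t \<le> 1" for t
    using that z mult_left_le_one_le[of "norm z" t] by (simp add: mult.commute)
  have mem: "of_real t * z \<in> unit_disc" if "0 \<le> t" "t \<le> 1" for t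
    using tz[OF that] that by (simp add: norm_mult)
  \<comment> \<open>The set \<open>S\<close> stays free: continuity on [0,1] uses one-sided
    derivatives at the ends, the mean value inequality uses full ones inside.\<close>
  have dF: "((\<lambda>t. F (of_real t * z)) has_vector_derivative h (of_real t * z) * z) (at t within S)"
    if "0 \<le> t" "t \<le> 1" for t S
  proof -
    have "((\<lambda>t. of_real t * z) has_vector_derivative z) (at t within S)"
      by (auto intro!: derivative_eq_intros)
    moreover have "(F has_field_derivative h (of_real t * z))
        (at (of_real t * z) within (\<lambda>t. of_real t * z) ` S)"
      using F[OF mem[OF that]] by (rule has_field_derivative_at_within)
    ultimately show ?thesis
      using field_vector_diff_chain_within by (fastforce simp: o_def mult.commute)
  qed
  have d\<phi>: "(\<phi> has_vector_derivative \<phi>' t) (at t within S)" if "0 \<le> t" "t \<le> 1" for t S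
    unfolding has_real_derivative_iff_has_vector_derivative[symmetric] \<phi>_def \<phi>'_def
    using tz[OF that] \<open>\<gamma> > 0\<close>
    by (auto intro!: derivative_eq_intros simp: field_simps powr_diff powr_minus powr_add)
  have "norm (F (of_real 1 * z) - F (of_real 0 * z)) \<le> \<phi> 1 - \<phi> 0"
  proof (rule differentiable_bound_general)
    show "continuous_on {0..1} (\<lambda>t. F (of_real t * z))"
      using dF
      by (intro continuous_on_vector_derivative[where f' = "\<lambda>t. h (of_real t * z) * z"]) simp
    show "continuous_on {0..1} \<phi>"
      using d\<phi> by (intro continuous_on_vector_derivative[where f' = \<phi>']) simp
    show "norm (h (of_real t * z) * z) \<le> \<phi>' t" if "0 < t" "t < 1" for t
      using h[OF mem[of t]] that
      by (auto simp: norm_mult \<phi>'_def intro: mult_right_mono)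
  qed (use dF[where S=UNIV] d\<phi>[where S=UNIV] in auto)
  \<comment> \<open>The increment of \<phi> is K|z| + (M/\<gamma>)(1 - |z|) powr (-\<gamma>) -
    M/\<gamma>; the first term is enlarged to \<open>K\<close> and the last one dropped.\<close>
  moreover have "K * norm z \<le> K" using z \<open>K \<ge> 0\<close> by (simp add: mult_left_le)
  moreover have "M / \<gamma> \<ge> 0" using \<open>M \<ge> 0\<close> \<open>\<gamma> > 0\<close> by simp
  ultimately show ?thesis using \<open>F 0 = 0\<close> by (simp add: \<phi>_def)
qed

text \<open>The weight cancels the singular term and stays on \<open>K\<close>, whose contribution
  therefore vanishes at the boundary. Only \<open>M / \<gamma>\<close> survives there, which is what
  the little-o case exploits.\<close>

lemma weighted_primitive_le:
  fixes F :: "complex \<Rightarrow> complex"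
  assumes F: "\<And>w. w \<in> unit_disc \<Longrightarrow> (F has_field_derivative h w) (at w)" and "F 0 = 0"
    and h: "\<And>w. w \<in> unit_disc \<Longrightarrow> norm (h w) \<le> K + M * (1 - norm w) powr (- (\<gamma> + 1))"
    and "K \<ge> 0" "M \<ge> 0" "\<gamma> > 0" and z: "norm z < 1"
  shows "(1 - norm z) powr \<gamma> * norm (F z) \<le> K * (1 - norm z) powr \<gamma> + M / \<gamma>"
proof -
  have "(1 - norm z) powr \<gamma> * norm (F z)
      \<le> (1 - norm z) powr \<gamma> * (K + M / \<gamma> * (1 - norm z) powr (- \<gamma>))"
    using norm_primitive_le[OF assms] by (intro mult_left_mono) auto
  also have "\<dots> = K * (1 - norm z) powr \<gamma> + M / \<gamma>"
    using z by (simp add: powr_minus field_simps)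
  finally show ?thesis .
qed

lemma norm_le_of_weighted_le:
  assumes "norm w < 1" and "(1 - norm w) powr a * x \<le> M"
  shows "x \<le> M * (1 - norm w) powr (- a)"
  using assms by (simp add: powr_minus field_simps)

lemma growth_norm_primitive_finite:
  fixes F :: "complex \<Rightarrow> complex"
  assumes F: "\<And>w. w \<in> unit_disc \<Longrightarrow> (F has_field_derivative h w) (at w)" "F 0 = 0"
    and "\<gamma> > 0" and fin: "growth_norm (\<gamma> + 1) h < \<infinity>"
  shows "growth_norm \<gamma> F < \<infinity>"
proof -
  obtain M where M: "M \<ge> 0"
    "\<And>z. z \<in> unit_disc \<Longrightarrow> (1 - norm z) powr (\<gamma> + 1) * norm (h z) \<le> M"
    using fin unfolding growth_norm_lt_top_iff by blast
  \<comment> \<open>The summand 0 is the value of \<open>K\<close> in the radial estimate.\<close>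
  have "norm (h w) \<le> 0 + M * (1 - norm w) powr (- (\<gamma> + 1))" if "w \<in> unit_disc" for w
    using norm_le_of_weighted_le[OF _ M(2)[OF that]] that by simp
  then have "(1 - norm z) powr \<gamma> * norm (F z) \<le> M / \<gamma>" if "z \<in> unit_disc" for z
    using weighted_primitive_le[OF F, of 0 M \<gamma> z] M(1) \<open>\<gamma> > 0\<close> that by simp
  then show ?thesis
    unfolding growth_norm_lt_top_iff using M(1) \<open>\<gamma> > 0\<close> by (intro exI[of _ "M / \<gamma>"]) auto
qed

lemma weighted_primitive_tendsto_0:
  fixes F :: "complex \<Rightarrow> complex"
  assumes F: "\<And>w. w \<in> unit_disc \<Longrightarrow> (F has_field_derivative h w) (at w)" "F 0 = 0"
    and "\<gamma> > 0" and cont: "continuous_on unit_disc h"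
    and lim: "((\<lambda>z. (1 - norm z) powr (\<gamma> + 1) * norm (h z)) \<longlongrightarrow> 0) (filtercomap norm (at_left 1))"
  shows "((\<lambda>z. (1 - norm z) powr \<gamma> * norm (F z)) \<longlongrightarrow> 0) (filtercomap norm (at_left 1))"
  unfolding weighted_tendsto_0_iff
proof (intro allI impI)
  fix e :: real assume "e > 0"
  define M where "M = \<gamma> * e / 2"
  have M: "M > 0" "M / \<gamma> = e / 2" using \<open>e > 0\<close> \<open>\<gamma> > 0\<close> by (auto simp: M_def)
  obtain \<rho> where \<rho>: "\<rho> < 1"
    "\<And>w. \<rho> < norm w \<Longrightarrow> norm w < 1 \<Longrightarrow> (1 - norm w) powr (\<gamma> + 1) * norm (h w) < M"
    using lim M(1) unfolding weighted_tendsto_0_iff by blast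
  \<comment> \<open>Smallness holds only beyond radius \<rho>; on the compact remainder continuity
    supplies \<open>K\<close>. For negative \<rho> that remainder is empty.\<close>
  have "bounded (h ` cball 0 \<rho>)"
    using \<rho>(1) by (intro compact_imp_bounded compact_continuous_image
        continuous_on_subset[OF cont]) auto
  then obtain K where K: "K > 0" "\<And>w. norm w \<le> \<rho> \<Longrightarrow> norm (h w) \<le> K"
    unfolding bounded_pos by auto
  have h: "norm (h w) \<le> K + M * (1 - norm w) powr (- (\<gamma> + 1))" if "w \<in> unit_disc" for w
  proof (cases "norm w \<le> \<rho>")
    case True
    then show ?thesis using K(2)[OF True] M(1) by (simp add: add_increasing2)
  next
    case False
    then have "norm (h w) \<le> M * (1 - norm w) powr (- (\<gamma> + 1))"
      using \<rho>(2)[of w] that by (intro norm_le_of_weighted_le) auto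
    then show ?thesis using K(1) by simp
  qed
  \<comment> \<open>Chosen to solve \<open>K * s powr \<gamma> = e / 2\<close>; within distance
    \<open>s\<close> of the unit circle the \<open>K\<close> term is below e/2, and
    \<open>M / \<gamma>\<close> is the other half of \<open>e\<close>.\<close>
  define s where "s = (e / (2 * K)) powr (1 / \<gamma>)"
  have s: "s > 0" "K * s powr \<gamma> = e / 2"
    using \<open>e > 0\<close> K(1) \<open>\<gamma> > 0\<close> by (auto simp: s_def powr_powr)
  show "\<exists>\<rho><1. \<forall>z. \<rho> < norm z \<longrightarrow> norm z < 1 \<longrightarrow> (1 - norm z) powr \<gamma> * norm (F z) < e"
  proof (intro exI[of _ "1 - s"] conjI allI impI)
    fix z :: complex assume z: "1 - s < norm z" "norm z < 1"
    have "K * (1 - norm z) powr \<gamma> < K * s powr \<gamma>"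
      using z K(1) \<open>\<gamma> > 0\<close> by (intro mult_strict_left_mono powr_less_mono2) auto
    moreover have "(1 - norm z) powr \<gamma> * norm (F z) \<le> K * (1 - norm z) powr \<gamma> + M / \<gamma>"
      using weighted_primitive_le[OF F h] K(1) M(1) \<open>\<gamma> > 0\<close> z(2) by simp
    ultimately show "(1 - norm z) powr \<gamma> * norm (F z) < e"
      using M(2) s(2) by simp
  qed (use s in simp)
qed

section \<open>Optimal domains of the Volterra operator\<close>

theorem proposition3p5:
  fixes g :: "complex \<Rightarrow> complex" and \<gamma> :: real
  assumes "g \<in> bloch_space"
    and "\<not> g constant_on unit_disc"
    and "\<gamma> > 0"
  shows "(optimal_domain g (growth_space \<gamma>)
            = {f \<in> analytic_disc. (\<lambda>z. f z * deriv g z) \<in> growth_space (\<gamma> + 1)}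
          \<and> (\<exists>C::real. C > 0 \<and> (\<forall>f \<in> optimal_domain g (growth_space \<gamma>).
                growth_norm (\<gamma> + 1) (\<lambda>z. f z * deriv g z)
                  \<le> ennreal C * optimal_domain_norm g \<gamma> f)))
       \<and> (optimal_domain g (little_growth_space \<gamma>)
            = {f \<in> analytic_disc. (\<lambda>z. f z * deriv g z) \<in> little_growth_space (\<gamma> + 1)}
          \<and> (\<exists>C::real. C > 0 \<and> (\<forall>f \<in> optimal_domain g (little_growth_space \<gamma>).
                growth_norm (\<gamma> + 1) (\<lambda>z. f z * deriv g z)
                  \<le> ennreal C * optimal_domain_norm g \<gamma> f)))"
proof -
  have g: "g \<in> analytic_disc"
    using assms(1) by (simp add: bloch_space_def)
  have prod: "(\<lambda>z. f z * deriv g z) \<in> analytic_disc" if "f \<in> analytic_disc" for f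
    using that g by (auto simp: analytic_disc_def intro!: holomorphic_intros)
  note vol = volterra_has_field_derivative[OF _ g]
  note volh = volterra_in_analytic_disc[OF _ g]
  have hol: "volterra g f holomorphic_on unit_disc" if "f \<in> analytic_disc" for f
    using volh[OF that] by (simp add: analytic_disc_def)
  have deriv: "deriv (volterra g f) z = f z * deriv g z"
    if "f \<in> analytic_disc" "z \<in> unit_disc" for f z
    using vol[OF that] by (rule DERIV_imp_deriv)
  have norm_le: "growth_norm (\<gamma> + 1) (\<lambda>z. f z * deriv g z)
      \<le> ennreal (2 powr (\<gamma> + 1)) * growth_norm \<gamma> (volterra g f)" if "f \<in> analytic_disc" for f
    using hol[OF that] \<open>\<gamma> > 0\<close> deriv[OF that] by (rule growth_norm_deriv_le)
  have big: "growth_norm \<gamma> (volterra g f) < \<infinity> \<longleftrightarrow>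
      growth_norm (\<gamma> + 1) (\<lambda>z. f z * deriv g z) < \<infinity>" if "f \<in> analytic_disc" for f
  proof
    assume "growth_norm \<gamma> (volterra g f) < \<infinity>"
    then have "ennreal (2 powr (\<gamma> + 1)) * growth_norm \<gamma> (volterra g f) < \<infinity>"
      by (simp add: ennreal_mult_less_top)
    with norm_le[OF that] show "growth_norm (\<gamma> + 1) (\<lambda>z. f z * deriv g z) < \<infinity>"
      by (rule le_less_trans)
  next
    assume "growth_norm (\<gamma> + 1) (\<lambda>z. f z * deriv g z) < \<infinity>"
    with vol[OF that] volterra_0 \<open>\<gamma> > 0\<close> show "growth_norm \<gamma> (volterra g f) < \<infinity>"
      by (rule growth_norm_primitive_finite)
  qed
  have little: "((\<lambda>z. (1 - norm z) powr \<gamma> * norm (volterra g f z)) \<longlongrightarrow> 0)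
        (filtercomap norm (at_left 1)) \<longleftrightarrow>
      ((\<lambda>z. (1 - norm z) powr (\<gamma> + 1) * norm (f z * deriv g z)) \<longlongrightarrow> 0)
        (filtercomap norm (at_left 1))" if "f \<in> analytic_disc" for f
    using weighted_deriv_tendsto_0[OF hol[OF that] \<open>\<gamma> > 0\<close> deriv[OF that]]
      weighted_primitive_tendsto_0[OF vol[OF that] volterra_0 \<open>\<gamma> > 0\<close>
        holomorphic_on_imp_continuous_on[OF prod[OF that, unfolded analytic_disc_def mem_Collect_eq]]]
    by blast
  \<comment> \<open>The Cauchy estimate holds in \<open>ennreal\<close> for every analytic
    \<open>f\<close>, so the same constant \<open>2 powr (\<gamma> + 1)\<close> works for both
    target spaces \<open>X\<close>.\<close>
  have "\<exists>C::real. C > 0 \<and> (\<forall>f \<in> optimal_domain g X.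
      growth_norm (\<gamma> + 1) (\<lambda>z. f z * deriv g z) \<le> ennreal C * optimal_domain_norm g \<gamma> f)" for X
    using norm_le
    by (intro exI[of _ "2 powr (\<gamma> + 1)"]) (auto simp: optimal_domain_def optimal_domain_norm_def)
  \<comment> \<open>Membership also demands analyticity, of the Volterra integral on one side and of
    the product on the other; \<open>volh\<close> and \<open>prod\<close> provide it.\<close>
  moreover have "optimal_domain g (growth_space \<gamma>)
      = {f \<in> analytic_disc. (\<lambda>z. f z * deriv g z) \<in> growth_space (\<gamma> + 1)}"
    using big prod volh unfolding optimal_domain_def growth_space_def by blast
  moreover have "optimal_domain g (little_growth_space \<gamma>)
      = {f \<in> analytic_disc. (\<lambda>z. f z * deriv g z) \<in> little_growth_space (\<gamma> + 1)}"
    using little prod volh unfolding optimal_domain_def little_growth_space_def by blast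
  ultimately show ?thesis by blast
qed

end
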